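(* Let $\epsilon,\delta,\eta,\nu>0$ and set $r=\frac{8\ln(2/\nu)}{\eta^2}$ and $w=\frac{\sqrt{32r\ln(2/\delta)}}{\epsilon}\ln(4r/\delta)$; assume $n$ is such that $\frac{w}{n}<\frac12$ and $\frac1w<\frac12$. Let $G$ be an undirected graph on $n$ vertices with edge weights $w_{u,v}\in[0,1]$, and let $\tilde L$ be the output of the following randomized algorithm (Algorithm 1): replace each $w_{u,v}$ ($u\ne v$) by $\frac wn+\left(1-\frac wn\right)w_{u,v}$ to obtain a graph $H$; pick an $r\times\binom n2$ matrix $M$ of i.i.d. $\mathcal N(0,1)$ entries; output $\tilde L=\frac1rE_H^{\mathsf T}M^{\mathsf T}ME_H$. For a nonempty $S\subsetneq V(G)$ with $|S|=s$, define (Algorithm 2) $R(S)=\frac{1}{1-\frac wn}\left(\mathbf 1_S^{\mathsf T}\tilde L\mathbf 1_S-w\frac{s(n-s)}{n}\right)$. Then for every $\eta,\nu>0$ and every nonempty $S$ of size $s$, $R$ gives an $(\eta,\tau,\nu)$-approximation for cut queries, i.e. $$\Pr\left[(1-\eta)\Phi_G(S)-\tau\le R(S)\le(1+\eta)\Phi_G(S)+\tau\right]\ge1-\nu,$$ where $\tau=O\!\left(s\cdot\frac{\sqrt{\ln(1/\delta)\ln(1/\nu)}}{\epsilon}\left(\ln(1/\delta)+\ln\!\left(\ln(1/\nu)/\eta^2\right)\right)\right)$.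
   Context: The edge matrix $E_G$ of a weighted graph $G$ on vertices ordered arbitrarily is the $\binom n2\times n$ matrix with one row for each pair $\{u,v\}$, $u<v$, whose entries are $\sqrt{w_{u,v}}$ in column $u$, $-\sqrt{w_{u,v}}$ in column $v$, and $0$ elsewhere. $\mathbf 1_S\in\{0,1\}^n$ is the indicator vector of $S$. The cut value is $\Phi_G(S)=\sum_{u\in S,v\notin S}w_{u,v}$. The $O(\cdot)$ hides an absolute constant; the probability is over the randomness of $M$.
   Formalization: Proved for η ≤ 1, with r rounded up to an integer and the O-bound on τ asserted for δ, ν ≤ 1/2; the claim fails for large η (η = 10, r = 1, complete graph) and the O-expression vanishes or turns negative as δ or ν approaches 1. *)

theory Defs
  imports "HOL-Probability.Probability" "Jordan_Normal_Form.Matrix"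
begin

unbundle no inner_syntax
no_notation Finite_Cartesian_Product.vec_nth (infixl \<open>$\<close> 90)

text \<open>A graph on the vertices \<open>0, \<dots>, n - 1\<close> is given by its weight function; the order of the
  vertices is that of the natural numbers. Values on the diagonal are never used.\<close>

definition weighted_graph :: "nat \<Rightarrow> (nat \<Rightarrow> nat \<Rightarrow> real) \<Rightarrow> bool" where
  "weighted_graph n W \<longleftrightarrow>
     (\<forall>u<n. \<forall>v<n. u \<noteq> v \<longrightarrow> W u v = W v u \<and> 0 \<le> W u v \<and> W u v \<le> 1)"

definition cut_value :: "nat \<Rightarrow> (nat \<Rightarrow> nat \<Rightarrow> real) \<Rightarrow> nat set \<Rightarrow> real" where
  "cut_value n W S = (\<Sum>u\<in>S. \<Sum>v\<in>{..<n} - S. W u v)"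

definition indicator_vec :: "nat \<Rightarrow> nat set \<Rightarrow> real vec" where
  "indicator_vec n S = vec n (\<lambda>i. if i \<in> S then 1 else 0)"

definition vertex_pairs :: "nat \<Rightarrow> (nat \<times> nat) list" where
  "vertex_pairs n = [(u, v). v \<leftarrow> [0..<n], u \<leftarrow> [0..<v]]"

lemma set_vertex_pairs: "set (vertex_pairs n) = {(u, v). u < v \<and> v < n}"
  by (auto simp: vertex_pairs_def)

lemma length_vertex_pairs: "length (vertex_pairs n) = n choose 2"
  by (induction n) (simp_all add: vertex_pairs_def numeral_2_eq_2)

lemma distinct_vertex_pairs: "distinct (vertex_pairs n)"
  by (induction n) (auto simp: vertex_pairs_def distinct_map inj_on_def)

definition edge_matrix :: "nat \<Rightarrow> (nat \<Rightarrow> nat \<Rightarrow> real) \<Rightarrow> real mat" where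
  "edge_matrix n W = mat (n choose 2) n (\<lambda>(k, j).
     let (u, v) = vertex_pairs n ! k in
       if j = u then sqrt (W u v) else if j = v then - sqrt (W u v) else 0)"

text \<open>The number of rows of the Gaussian matrix has to be an integer, so
  \<open>8 ln (2 / \<nu>) / \<eta>\<^sup>2\<close> is rounded up. The rounded value is used in all formulas.\<close>

definition num_rows :: "real \<Rightarrow> real \<Rightarrow> nat" where
  "num_rows \<eta> \<nu> = nat \<lceil>8 * ln (2 / \<nu>) / \<eta>\<^sup>2\<rceil>"

text \<open>For \<open>\<delta> > 2\<close> the radicand below is negative and the value is meaningless; for \<open>\<delta> < 2\<close> and
  \<open>\<nu> < 2\<close> it is positive.\<close>

definition base_weight :: "real \<Rightarrow> real \<Rightarrow> real \<Rightarrow> real \<Rightarrow> real" where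
  "base_weight \<epsilon> \<delta> \<eta> \<nu> =
     (let r = real (num_rows \<eta> \<nu>)
      in sqrt (32 * r * ln (2 / \<delta>)) / \<epsilon> * ln (4 * r / \<delta>))"

definition perturbed_graph :: "nat \<Rightarrow> real \<Rightarrow> (nat \<Rightarrow> nat \<Rightarrow> real) \<Rightarrow> nat \<Rightarrow> nat \<Rightarrow> real" where
  "perturbed_graph n w W u v =
     (if u = v then W u v else w / real n + (1 - w / real n) * W u v)"

definition gaussian_entries :: "nat \<Rightarrow> nat \<Rightarrow> (nat \<times> nat \<Rightarrow> real) measure" where
  "gaussian_entries r m =
     (\<Pi>\<^sub>M ij \<in> {..<r} \<times> {..<m}. density lborel (normal_density 0 1))"

definition sanitized_laplacian ::
    "nat \<Rightarrow> nat \<Rightarrow> real \<Rightarrow> (nat \<Rightarrow> nat \<Rightarrow> real) \<Rightarrow> (nat \<times> nat \<Rightarrow> real) \<Rightarrow> real mat" where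
  "sanitized_laplacian n r w W \<omega> =
     (let E = edge_matrix n (perturbed_graph n w W);
          M = mat r (n choose 2) \<omega>
      in (1 / real r) \<cdot>\<^sub>m (E\<^sup>T * M\<^sup>T * M * E))"

definition cut_estimate :: "nat \<Rightarrow> real \<Rightarrow> real mat \<Rightarrow> nat set \<Rightarrow> real" where
  "cut_estimate n w L S =
     1 / (1 - w / real n) *
       (indicator_vec n S \<bullet> (L *\<^sub>v indicator_vec n S)
          - w * (real (card S) * (real n - real (card S)) / real n))"

text \<open>The argument of \<open>O(\<cdot>)\<close> in the additive error. It tends to zero or becomes negative for
  \<open>\<delta>\<close> or \<open>\<nu>\<close> close to one, so it is only meaningful as a bound when these parameters stay away
  from one; it is positive for \<open>\<delta> \<le> 1/2\<close>, \<open>\<nu> \<le> 1/2\<close>, \<open>0 < \<eta> \<le> 1\<close> and \<open>s > 0\<close>.\<close>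

definition error_order :: "real \<Rightarrow> real \<Rightarrow> real \<Rightarrow> real \<Rightarrow> nat \<Rightarrow> real" where
  "error_order \<epsilon> \<delta> \<eta> \<nu> s =
     real s * (sqrt (ln (1 / \<delta>) * ln (1 / \<nu>)) / \<epsilon>
       * (ln (1 / \<delta>) + ln (ln (1 / \<nu>) / \<eta>\<^sup>2)))"

end

theory Submission
  imports Defs
begin

text \<open>Let \<open>x\<close> be the image of the indicator vector of \<open>S\<close> under the edge matrix of the perturbed
  graph \<open>H\<close>. Then \<open>\<parallel>x\<parallel>\<^sup>2\<close> is the cut value of \<open>S\<close> in \<open>H\<close>, and the quadratic form of the output at
  \<open>S\<close> is \<open>\<parallel>M x\<parallel>\<^sup>2 / r\<close>, which is \<open>\<parallel>x\<parallel>\<^sup>2 / r\<close> times a chi-square variable with \<open>r\<close> degrees of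
  freedom. A Chernoff bound shows that it is within a factor \<open>1 \<plusminus> \<eta>\<close> of \<open>\<parallel>x\<parallel>\<^sup>2\<close> except with
  probability \<open>2 exp (- r \<eta>\<^sup>2 / 8) \<le> \<nu>\<close>. Undoing the affine perturbation turns the relative error
  \<open>\<eta>\<close> on the added weight \<open>w s (n - s) / n\<close> into the additive error \<open>2 \<eta> w s\<close>, in which the factor
  \<open>\<eta>\<close> cancels the \<open>1 / \<eta>\<close> of \<open>w\<close>.\<close>

section \<open>Concentration of Gaussian quadratic forms\<close>

text \<open>The optimized Chernoff exponent is \<open>(a - ln (1 + a)) / 2\<close> per row; this
  estimate makes it at least \<open>a\<^sup>2 / 8\<close> for both signs of \<open>a\<close>. The
  gap between the two sides vanishes at 0, and its derivative has a sign that makes 0 a minimum on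
  (-1, 1]; beyond 1 that sign changes.\<close>

lemma ln_one_plus_le_quadratic:
  fixes a :: real
  assumes "-1 < a" "a \<le> 1"
  shows "ln (1 + a) \<le> a - a\<^sup>2 / 4"
proof -
  define f where "f x = x - x\<^sup>2 / 4 - ln (1 + x)" for x :: real
  have deriv: "(f has_real_derivative x * (1 - x) / (2 * (1 + x))) (at x)" if "-1 < x" for x
    unfolding f_def using that
    by (auto intro!: derivative_eq_intros simp: field_simps power2_eq_square)
  have "f 0 \<le> f a"
  proof (cases "0 \<le> a")
    case True
    show ?thesis
    proof (rule DERIV_nonneg_imp_nondecreasing[OF True])
      fix x assume "0 \<le> x" "x \<le> a"
      then show "\<exists>y. (f has_real_derivative y) (at x) \<and> 0 \<le> y"
        using assms by (intro exI[of _ "x * (1 - x) / (2 * (1 + x))"] conjI deriv) auto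
    qed
  next
    case False
    then have "a \<le> 0" by simp
    then show ?thesis
    proof (rule DERIV_nonpos_imp_nonincreasing)
      fix x assume "a \<le> x" "x \<le> 0"
      then show "\<exists>y. (f has_real_derivative y) (at x) \<and> y \<le> 0"
        using assms by (intro exI[of _ "x * (1 - x) / (2 * (1 + x))"] conjI deriv)
          (auto intro!: divide_nonpos_pos mult_nonpos_nonneg)
    qed
  qed
  then show ?thesis by (simp add: f_def)
qed

text \<open>The exponential weight tilts a centred normal density into a multiple of another one:
  with \<open>b = 1 - 2 * t * \<sigma>\<^sup>2\<close> the variance is divided by \<open>b\<close>,
  and the integral is the leftover normalizing factor. Negative \<open>t\<close> is allowed and
  serves the lower tail.\<close>

lemma nn_integral_exp_square_normal:
  assumes "0 < \<sigma>" "2 * t * \<sigma>\<^sup>2 < 1"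
  shows "(\<integral>\<^sup>+x. ennreal (normal_density 0 \<sigma> x) * ennreal (exp (t * x\<^sup>2)) \<partial>lborel)
    = ennreal (1 / sqrt (1 - 2 * t * \<sigma>\<^sup>2))"
proof -
  define b where "b = 1 - 2 * t * \<sigma>\<^sup>2"
  have b: "0 < b" using assms by (simp add: b_def)
  have eq: "normal_density 0 \<sigma> x * exp (t * x\<^sup>2) = 1 / sqrt b * normal_density 0 (\<sigma> / sqrt b) x" for x
  proof -
    have exponent: "- x\<^sup>2 / (2 * \<sigma>\<^sup>2) + t * x\<^sup>2 = - x\<^sup>2 / (2 * (\<sigma> / sqrt b)\<^sup>2)"
    proof -
      have "- x\<^sup>2 / (2 * \<sigma>\<^sup>2) + t * x\<^sup>2 = - x\<^sup>2 * b / (2 * \<sigma>\<^sup>2)"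
        using assms unfolding b_def by (simp add: field_simps)
      then show ?thesis using b by (simp add: power_divide)
    qed
    have "sqrt (2 * pi * (\<sigma> / sqrt b)\<^sup>2) = sqrt (2 * pi * \<sigma>\<^sup>2) / sqrt b"
      using b by (simp add: power_divide real_sqrt_divide)
    then show ?thesis
      using b exponent by (simp add: normal_density_def exp_add[symmetric])
  qed
  have "(\<integral>\<^sup>+x. ennreal (normal_density 0 \<sigma> x) * ennreal (exp (t * x\<^sup>2)) \<partial>lborel)
      = (\<integral>\<^sup>+x. ennreal (1 / sqrt b) * ennreal (normal_density 0 (\<sigma> / sqrt b) x) \<partial>lborel)"
    using b by (intro nn_integral_cong) (simp add: ennreal_mult'[symmetric] eq)
  also have "\<dots> = ennreal (1 / sqrt b) * (\<integral>\<^sup>+x. ennreal (normal_density 0 (\<sigma> / sqrt b) x) \<partial>lborel)"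
    by (intro nn_integral_cmult) simp
  also have "(\<integral>\<^sup>+x. ennreal (normal_density 0 (\<sigma> / sqrt b) x) \<partial>lborel) = 1"
    using assms b by (subst nn_integral_eq_integral) auto
  finally show ?thesis by (simp add: b_def)
qed

section \<open>Joint law of the matrix entries and of the row sums\<close>

lemma prob_space_gaussian_entries: "prob_space (gaussian_entries r m)"
  unfolding gaussian_entries_def by (intro prob_space_PiM prob_space_normal_density) simp

lemma sets_gaussian_entries:
  "sets (gaussian_entries r m) = sets (\<Pi>\<^sub>M ij \<in> {..<r} \<times> {..<m}. borel)"
  unfolding gaussian_entries_def by (intro sets_PiM_cong) auto

lemma measurable_gaussian_entry:
  assumes "ij \<in> {..<r} \<times> {..<m}"
  shows "(\<lambda>\<omega>. \<omega> ij) \<in> borel_measurable (gaussian_entries r m)"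
  using measurable_component_singleton[OF assms, of "\<lambda>_. borel"]
    measurable_cong_sets[OF sets_gaussian_entries refl] by blast

text \<open>Independence amounts to the joint law being the product of the marginals, and the joint
  map is the identity on a product space.\<close>

lemma indep_gaussian_entries:
  "prob_space.indep_vars (gaussian_entries r m) (\<lambda>_. borel) (\<lambda>ij \<omega>. \<omega> ij) ({..<r} \<times> {..<m})"
proof (cases "{..<r} \<times> {..<m} = {}")
  \<comment> \<open>The criterion applied in the other case needs a nonempty index set.\<close>
  case True
  interpret prob_space "gaussian_entries r m" by (rule prob_space_gaussian_entries)
  show ?thesis unfolding True by (simp add: indep_vars_def indep_sets_def)
next
  case False
  interpret prob_space "gaussian_entries r m" by (rule prob_space_gaussian_entries)
  let ?N = "density lborel (normal_density 0 1)"
  have *: "distr (gaussian_entries r m) borel (\<lambda>\<omega>. \<omega> ij) = ?N" if "ij \<in> {..<r} \<times> {..<m}" for ij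
  proof -
    have "distr (gaussian_entries r m) borel (\<lambda>\<omega>. \<omega> ij) = distr (gaussian_entries r m) ?N (\<lambda>\<omega>. \<omega> ij)"
      by (intro distr_cong) auto
    also have "\<dots> = ?N"
      unfolding gaussian_entries_def
      by (rule distr_PiM_component[where M="\<lambda>_. ?N", OF _ that]) (simp add: prob_space_normal_density)
    finally show ?thesis .
  qed
  show ?thesis
  proof (subst indep_vars_iff_distr_eq_PiM'[OF False measurable_gaussian_entry], assumption)
    have "distr (gaussian_entries r m) (\<Pi>\<^sub>M ij \<in> {..<r} \<times> {..<m}. borel)
        (\<lambda>\<omega>. \<lambda>ij\<in>{..<r} \<times> {..<m}. \<omega> ij)
      = distr (gaussian_entries r m) (gaussian_entries r m) (\<lambda>\<omega>. \<omega>)"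
    \<comment> \<open>Points of the product space are already \<open>undefined\<close> outside the
      index set, so restricting them changes nothing.\<close>
    proof (intro distr_cong refl)
      fix \<omega> assume "\<omega> \<in> space (gaussian_entries r m)"
      then show "(\<lambda>ij\<in>{..<r} \<times> {..<m}. \<omega> ij) = \<omega>"
        by (auto simp: gaussian_entries_def space_PiM PiE_restrict)
    qed (simp add: sets_gaussian_entries)
    also have "\<dots> = gaussian_entries r m" by simp
    also have "\<dots> = (\<Pi>\<^sub>M ij\<in>{..<r} \<times> {..<m}. distr (gaussian_entries r m) borel (\<lambda>\<omega>. \<omega> ij))"
      unfolding gaussian_entries_def[of r m] using *
      by (intro PiM_cong refl) (simp add: gaussian_entries_def)
    finally show "distr (gaussian_entries r m) (\<Pi>\<^sub>M ij \<in> {..<r} \<times> {..<m}. borel)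
        (\<lambda>\<omega>. \<lambda>ij\<in>{..<r} \<times> {..<m}. \<omega> ij)
      = (\<Pi>\<^sub>M ij\<in>{..<r} \<times> {..<m}. distr (gaussian_entries r m) borel (\<lambda>\<omega>. \<omega> ij))" .
  qed
qed

lemma distributed_gaussian_entry:
  assumes "ij \<in> {..<r} \<times> {..<m}"
  shows "distributed (gaussian_entries r m) lborel (\<lambda>\<omega>. \<omega> ij) (normal_density 0 1)"
proof -
  let ?N = "density lborel (normal_density 0 1)"
  have "distr (gaussian_entries r m) lborel (\<lambda>\<omega>. \<omega> ij) = distr (gaussian_entries r m) ?N (\<lambda>\<omega>. \<omega> ij)"
    by (intro distr_cong) auto
  also have "\<dots> = ?N"
    unfolding gaussian_entries_def
    by (rule distr_PiM_component[where M="\<lambda>_. ?N", OF _ assms]) (simp add: prob_space_normal_density)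
  finally show ?thesis
    using measurable_gaussian_entry[OF assms] by (simp add: distributed_def)
qed

text \<open>Sums of independent centred normals are normal with added variances, so every coordinate
  of the image of \<open>x\<close> depends in law only on the norm of \<open>x\<close>.\<close>

lemma distributed_gaussian_row_sum:
  assumes "i < r" "0 < (\<Sum>j<m. (x j)\<^sup>2)"
  shows "distributed (gaussian_entries r m) lborel (\<lambda>\<omega>. \<Sum>j<m. \<omega> (i, j) * x j)
    (normal_density 0 (sqrt (\<Sum>j<m. (x j)\<^sup>2)))"
proof -
  interpret prob_space "gaussian_entries r m" by (rule prob_space_gaussian_entries)
  \<comment> \<open>A zero coefficient gives a constant summand, which has no density, while
    \<open>sum_indep_normal\<close> wants positive deviations. Such summands are dropped; the
    positive norm keeps \<open>J\<close> nonempty.\<close>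
  define J where "J = {j. j < m \<and> x j \<noteq> 0}"
  have J: "finite J" "J \<subseteq> {..<m}" by (auto simp: J_def)
  have "J \<noteq> {}"
  proof
    assume "J = {}"
    then have "(\<Sum>j<m. (x j)\<^sup>2) = 0" by (auto simp: J_def)
    with assms show False by simp
  qed
  have indep: "indep_vars (\<lambda>_. borel) (\<lambda>j \<omega>. \<omega> (i, j)) J"
  proof -
    have "indep_vars (\<lambda>j. \<Pi>\<^sub>M ij \<in> {(i, j)}. borel) (\<lambda>j \<omega>. restrict (\<lambda>ij. \<omega> ij) {(i, j)}) J"
      using assms(1) J(2)
      by (intro indep_vars_restrict[OF indep_gaussian_entries]) (auto simp: disjoint_family_on_def)
    then have "indep_vars (\<lambda>_. borel) (\<lambda>j \<omega>. restrict (\<lambda>ij. \<omega> ij) {(i, j)} (i, j)) J"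
      by (rule indep_vars_compose2[where Y="\<lambda>j \<rho>. \<rho> (i, j)"]) (simp add: measurable_component_singleton)
    then show ?thesis by simp
  qed
  have "distributed (gaussian_entries r m) lborel (\<lambda>\<omega>. \<Sum>j\<in>J. \<omega> (i, j) * x j)
    (normal_density (\<Sum>j\<in>J. 0) (sqrt (\<Sum>j\<in>J. \<bar>x j\<bar>\<^sup>2)))"
  proof (rule sum_indep_normal[OF J(1) \<open>J \<noteq> {}\<close>])
    show "indep_vars (\<lambda>_. borel) (\<lambda>j \<omega>. \<omega> (i, j) * x j) J"
      by (rule indep_vars_compose2[OF indep, where Y="\<lambda>j y. y * x j"]) simp
    fix j assume "j \<in> J"
    then have j: "x j \<noteq> 0" "j < m" by (auto simp: J_def)
    then show "0 < \<bar>x j\<bar>" by simp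
    from j show "distributed (gaussian_entries r m) lborel (\<lambda>\<omega>. \<omega> (i, j) * x j) (normal_density 0 \<bar>x j\<bar>)"
      using normal_density_affine[OF distributed_gaussian_entry, of "(i, j)" "x j" 0] assms(1)
      by (simp add: mult.commute)
  qed
  moreover have "(\<Sum>j\<in>J. \<omega> (i, j) * x j) = (\<Sum>j<m. \<omega> (i, j) * x j)" for \<omega> :: "nat \<times> nat \<Rightarrow> real"
    by (rule sum.mono_neutral_left) (auto simp: J_def)
  moreover have "(\<Sum>j\<in>J. \<bar>x j\<bar>\<^sup>2) = (\<Sum>j<m. (x j)\<^sup>2)"
    by simp (rule sum.mono_neutral_left, auto simp: J_def)
  ultimately show ?thesis by simp
qed

text \<open>Distinct rows read disjoint blocks of independent entries.\<close>

lemma indep_gaussian_row_sums: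
  "prob_space.indep_vars (gaussian_entries r m) (\<lambda>_. borel)
     (\<lambda>i \<omega>. \<Sum>j<m. \<omega> (i, j) * x j) {..<r}"
proof -
  interpret prob_space "gaussian_entries r m" by (rule prob_space_gaussian_entries)
  have "indep_vars (\<lambda>i. \<Pi>\<^sub>M ij \<in> {i} \<times> {..<m}. borel)
      (\<lambda>i \<omega>. restrict (\<lambda>ij. \<omega> ij) ({i} \<times> {..<m})) {..<r}"
    by (rule indep_vars_restrict[OF indep_gaussian_entries]) (auto simp: disjoint_family_on_def)
  then have "indep_vars (\<lambda>_. borel)
      (\<lambda>i \<omega>. \<Sum>j<m. restrict (\<lambda>ij. \<omega> ij) ({i} \<times> {..<m}) (i, j) * x j) {..<r}"
    by (rule indep_vars_compose2[where Y="\<lambda>i \<rho>. \<Sum>j<m. \<rho> (i, j) * x j"])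
      (auto intro!: borel_measurable_sum borel_measurable_times measurable_component_singleton)
  then show ?thesis by simp
qed

section \<open>Exponential moments and the Chernoff bound\<close>

lemma nn_integral_exp_gaussian_quadratic:
  assumes pos: "0 < (\<Sum>j<m. (x j)\<^sup>2)" and t: "2 * t * (\<Sum>j<m. (x j)\<^sup>2) < 1"
  shows "(\<integral>\<^sup>+\<omega>. ennreal (exp (t * (\<Sum>i<r. (\<Sum>j<m. \<omega> (i, j) * x j)\<^sup>2))) \<partial>gaussian_entries r m)
    = ennreal ((1 / sqrt (1 - 2 * t * (\<Sum>j<m. (x j)\<^sup>2))) ^ r)"
proof -
  interpret prob_space "gaussian_entries r m" by (rule prob_space_gaussian_entries)
  \<comment> \<open>The exponential of the sum is a product over independent rows, so its
    expectation factors. With nonnegative integrals no integrability has to be checked.\<close>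
  have "indep_vars (\<lambda>_. borel)
      (\<lambda>i \<omega>. ennreal (exp (t * (\<Sum>j<m. \<omega> (i, j) * x j)\<^sup>2))) {..<r}"
    by (rule indep_vars_compose2[OF indep_gaussian_row_sums, where Y="\<lambda>_ y. ennreal (exp (t * y\<^sup>2))"]) simp
  then have "(\<integral>\<^sup>+\<omega>. (\<Prod>i<r. ennreal (exp (t * (\<Sum>j<m. \<omega> (i, j) * x j)\<^sup>2))) \<partial>gaussian_entries r m)
      = (\<Prod>i<r. \<integral>\<^sup>+\<omega>. ennreal (exp (t * (\<Sum>j<m. \<omega> (i, j) * x j)\<^sup>2)) \<partial>gaussian_entries r m)"
    by (intro indep_vars_nn_integral) auto
  also have "\<dots> = (\<Prod>i<r. ennreal (1 / sqrt (1 - 2 * t * (\<Sum>j<m. (x j)\<^sup>2))))"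
  proof (intro prod.cong refl)
    fix i assume "i \<in> {..<r}"
    then have "(\<integral>\<^sup>+\<omega>. ennreal (exp (t * (\<Sum>j<m. \<omega> (i, j) * x j)\<^sup>2)) \<partial>gaussian_entries r m)
      = (\<integral>\<^sup>+y. ennreal (normal_density 0 (sqrt (\<Sum>j<m. (x j)\<^sup>2)) y) * ennreal (exp (t * y\<^sup>2)) \<partial>lborel)"
      by (intro distributed_nn_integral[OF distributed_gaussian_row_sum[OF _ pos], symmetric]) auto
    then show "(\<integral>\<^sup>+\<omega>. ennreal (exp (t * (\<Sum>j<m. \<omega> (i, j) * x j)\<^sup>2)) \<partial>gaussian_entries r m)
      = ennreal (1 / sqrt (1 - 2 * t * (\<Sum>j<m. (x j)\<^sup>2)))"
      using nn_integral_exp_square_normal[of "sqrt (\<Sum>j<m. (x j)\<^sup>2)" t] pos t by simp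
  qed
  also have "\<dots> = ennreal ((1 / sqrt (1 - 2 * t * (\<Sum>j<m. (x j)\<^sup>2))) ^ r)"
    using t by (simp add: ennreal_power)
  finally show ?thesis
    by (simp add: sum_distrib_left exp_sum prod_ennreal)
qed

text \<open>Both tails are treated at once: multiplying by \<open>a\<close> reverses the inequality
  when \<open>a\<close> is negative, so positive \<open>a\<close> gives the upper and negative
  \<open>a\<close> the lower tail. The proof is Markov's inequality for
  \<open>exp (t * Q \<omega>)\<close>.\<close>

lemma gaussian_quadratic_tail:
  fixes a :: real
  assumes pos: "0 < (\<Sum>j<m. (x j)\<^sup>2)" and a: "-1 < a" "a \<le> 1"
  shows "measure (gaussian_entries r m) {\<omega> \<in> space (gaussian_entries r m).
      a * ((1 + a) * (r * (\<Sum>j<m. (x j)\<^sup>2))) \<le> a * (\<Sum>i<r. (\<Sum>j<m. \<omega> (i, j) * x j)\<^sup>2)}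
    \<le> exp (- (r * a\<^sup>2 / 8))"
proof -
  let ?P = "gaussian_entries r m"
  interpret prob_space ?P by (rule prob_space_gaussian_entries)
  define V where "V = (\<Sum>j<m. (x j)\<^sup>2)"
  define Q where "Q \<omega> = (\<Sum>i<r. (\<Sum>j<m. \<omega> (i, j) * x j)\<^sup>2)" for \<omega> :: "nat \<times> nat \<Rightarrow> real"
  \<comment> \<open>the minimizer of the Chernoff bound; negative for the lower tail\<close>
  define t where "t = a / (2 * V * (1 + a))"
  have V: "0 < V" using pos by (simp add: V_def)
  have b: "1 - 2 * t * V = 1 / (1 + a)"
  proof -
    have "2 * t * V = a / (1 + a)" using V by (simp add: t_def)
    then show ?thesis using a by (simp add: field_simps)
  qed
  have meas: "Q \<in> borel_measurable ?P"
    unfolding Q_def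
    by (intro borel_measurable_sum borel_measurable_power borel_measurable_times measurable_gaussian_entry) auto
  \<comment> \<open>The Chernoff exponent is the slack in the tail event over a positive number,
    hence nonnegative exactly on that event, whatever the sign of \<open>a\<close>.\<close>
  have scale: "t * Q \<omega> - r * a / 2 = (a * Q \<omega> - a * ((1 + a) * (r * V))) / (2 * V * (1 + a))" for \<omega>
  proof -
    have "2 * V * (1 + a) \<noteq> 0" using V a by simp
    then have "r * a / 2 = a * ((1 + a) * (r * V)) / (2 * V * (1 + a))"
      by (subst nonzero_eq_divide_eq) (simp_all add: algebra_simps)
    then show ?thesis by (simp add: t_def diff_divide_distrib)
  qed
  have "emeasure ?P {\<omega> \<in> space ?P. a * ((1 + a) * (r * V)) \<le> a * Q \<omega>}
      \<le> emeasure ?P {\<omega> \<in> space ?P. 1 \<le> ennreal (exp (- (r * a / 2))) * ennreal (exp (t * Q \<omega>))}"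
  proof (rule emeasure_mono)
    show "{\<omega> \<in> space ?P. a * ((1 + a) * (r * V)) \<le> a * Q \<omega>}
      \<subseteq> {\<omega> \<in> space ?P. 1 \<le> ennreal (exp (- (r * a / 2))) * ennreal (exp (t * Q \<omega>))}"
    proof safe
      fix \<omega> assume "a * ((1 + a) * (r * V)) \<le> a * Q \<omega>"
      then have "0 \<le> t * Q \<omega> - r * a / 2"
        unfolding scale using V a by simp
      then have "1 \<le> exp (- (r * a / 2)) * exp (t * Q \<omega>)"
        by (simp add: exp_add[symmetric])
      then show "1 \<le> ennreal (exp (- (r * a / 2))) * ennreal (exp (t * Q \<omega>))"
        by (simp add: ennreal_mult'[symmetric])
    qed
  qed (use meas in measurable)
  also have "\<dots> \<le> ennreal (exp (- (r * a / 2))) *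
      (\<integral>\<^sup>+\<omega>. ennreal (exp (t * Q \<omega>)) * indicator (space ?P) \<omega> \<partial>?P)"
    by (rule nn_integral_Markov_inequality) (use meas in measurable)
  also have "(\<integral>\<^sup>+\<omega>. ennreal (exp (t * Q \<omega>)) * indicator (space ?P) \<omega> \<partial>?P)
      = (\<integral>\<^sup>+\<omega>. ennreal (exp (t * Q \<omega>)) \<partial>?P)"
    by (intro nn_integral_cong) auto
  also have "\<dots> = ennreal (sqrt (1 + a) ^ r)"
  proof -
    have "0 < 1 / (1 + a)" using a by simp
    then have "2 * t * V < 1" unfolding b[symmetric] by simp
    then show ?thesis
      using nn_integral_exp_gaussian_quadratic[OF pos, of t r] b
      by (simp add: Q_def V_def real_sqrt_divide)
  qed
  also have "ennreal (exp (- (r * a / 2))) * ennreal (sqrt (1 + a) ^ r)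
      = ennreal (exp (- (r * a / 2)) * sqrt (1 + a) ^ r)"
    by (simp add: ennreal_mult')
  also have "\<dots> \<le> ennreal (exp (- (r * a\<^sup>2 / 8)))"
  proof (rule ennreal_leI)
    \<comment> \<open>In exponential form the logarithmic estimate applies; its linear term cancels
      against \<open>r * a / 2\<close>.\<close>
    have "sqrt (1 + a) = exp (ln (1 + a) / 2)"
      using a by (simp add: ln_sqrt[symmetric])
    also have "\<dots> \<le> exp ((a - a\<^sup>2 / 4) / 2)"
      using ln_one_plus_le_quadratic[OF a] by simp
    finally have "sqrt (1 + a) ^ r \<le> exp ((a - a\<^sup>2 / 4) / 2) ^ r"
      using a by (intro power_mono) auto
    also have "\<dots> = exp (r * ((a - a\<^sup>2 / 4) / 2))"
      by (rule exp_of_nat_mult[symmetric])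
    finally have "exp (- (r * a / 2)) * sqrt (1 + a) ^ r
        \<le> exp (- (r * a / 2)) * exp (r * ((a - a\<^sup>2 / 4) / 2))"
      by simp
    also have "\<dots> = exp (- (r * a\<^sup>2 / 8))"
      unfolding exp_add[symmetric] by (simp add: field_simps)
    finally show "exp (- (r * a / 2)) * sqrt (1 + a) ^ r \<le> exp (- (r * a\<^sup>2 / 8))" .
  qed
  finally show ?thesis
    by (simp add: emeasure_eq_measure Q_def V_def)
qed

text \<open>A union bound over the two tails, with \<open>a\<close> equal to \<eta> and to
  -\<eta>.\<close>

theorem gaussian_quadratic_concentration:
  fixes \<eta> :: real
  assumes pos: "0 < (\<Sum>j<m. (x j)\<^sup>2)" and r: "0 < r" and \<eta>: "0 < \<eta>" "\<eta> \<le> 1"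
  shows "1 - 2 * exp (- (r * \<eta>\<^sup>2 / 8)) \<le> measure (gaussian_entries r m)
    {\<omega> \<in> space (gaussian_entries r m).
      \<bar>(\<Sum>i<r. (\<Sum>j<m. \<omega> (i, j) * x j)\<^sup>2) / r - (\<Sum>j<m. (x j)\<^sup>2)\<bar> \<le> \<eta> * (\<Sum>j<m. (x j)\<^sup>2)}"
proof -
  let ?P = "gaussian_entries r m"
  interpret prob_space ?P by (rule prob_space_gaussian_entries)
  define V where "V = (\<Sum>j<m. (x j)\<^sup>2)"
  define Q where "Q \<omega> = (\<Sum>i<r. (\<Sum>j<m. \<omega> (i, j) * x j)\<^sup>2)" for \<omega> :: "nat \<times> nat \<Rightarrow> real"
  define U where "U = {\<omega> \<in> space ?P. \<eta> * ((1 + \<eta>) * (r * V)) \<le> \<eta> * Q \<omega>}"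
  define L where "L = {\<omega> \<in> space ?P. (1 - \<eta>) * (r * V) > Q \<omega>}"
  define G where "G = {\<omega> \<in> space ?P. \<bar>Q \<omega> / r - V\<bar> \<le> \<eta> * V}"
  have meas[measurable]: "Q \<in> borel_measurable ?P"
    unfolding Q_def
    by (intro borel_measurable_sum borel_measurable_power borel_measurable_times measurable_gaussian_entry) auto
  have [measurable]: "U \<in> sets ?P" "L \<in> sets ?P" "G \<in> sets ?P"
    unfolding U_def L_def G_def by measurable
  have U: "prob U \<le> exp (- (r * \<eta>\<^sup>2 / 8))"
    using gaussian_quadratic_tail[OF pos, of \<eta> r] \<eta> unfolding U_def Q_def V_def by simp
  have L: "prob L \<le> exp (- (r * \<eta>\<^sup>2 / 8))"
  proof (cases "\<eta> = 1")
    \<comment> \<open>The tail bound excludes \<open>a = -1\<close>. Since \<open>L\<close> is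
      defined by a strict inequality, it would here force the sum of squares \<open>Q\<close> to be
      negative.\<close>
    case True
    have "L = {}"
      unfolding L_def True by (auto simp: Q_def not_less intro!: sum_nonneg)
    then show ?thesis by simp
  next
    case False
    let ?T = "{\<omega> \<in> space ?P. - \<eta> * ((1 + - \<eta>) * (r * V)) \<le> - \<eta> * Q \<omega>}"
    have "L \<subseteq> ?T" using \<eta> by (auto simp: L_def)
    moreover have "?T \<in> sets ?P" by measurable
    ultimately have "prob L \<le> prob ?T" by (intro finite_measure_mono)
    also have "\<dots> \<le> exp (- (r * \<eta>\<^sup>2 / 8))"
      using gaussian_quadratic_tail[OF pos, of "-\<eta>" r] \<eta> False unfolding Q_def V_def by simp
    finally show ?thesis .
  qed
  have "space ?P - G \<subseteq> U \<union> L"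
  proof
    fix \<omega> assume \<omega>: "\<omega> \<in> space ?P - G"
    then have "\<eta> * V < \<bar>Q \<omega> / r - V\<bar>" by (auto simp: G_def not_le)
    then have "(1 + \<eta>) * V < Q \<omega> / r \<or> Q \<omega> / r < (1 - \<eta>) * V"
      by (auto simp: algebra_simps abs_if split: if_splits)
    then have "(1 + \<eta>) * (r * V) < Q \<omega> \<or> Q \<omega> < (1 - \<eta>) * (r * V)"
      using r by (simp add: field_simps)
    with \<omega> \<eta> show "\<omega> \<in> U \<union> L" by (auto simp: U_def L_def)
  qed
  then have "prob (space ?P - G) \<le> prob (U \<union> L)"
    by (intro finite_measure_mono) auto
  also have "\<dots> \<le> prob U + prob L"
    by (intro measure_Un_le) auto
  finally have "1 - 2 * exp (- (r * \<eta>\<^sup>2 / 8)) \<le> prob G"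
    using U L by (simp add: prob_compl)
  then show ?thesis by (simp add: G_def Q_def V_def)
qed

section \<open>Cuts as quadratic forms\<close>

lemma sum_vertex_pairs:
  "(\<Sum>k<n choose 2. f (vertex_pairs n ! k)) = (\<Sum>p\<in>{(u, v). u < v \<and> v < n}. f p)"
  using sum.reindex_bij_betw[OF bij_betw_nth[OF distinct_vertex_pairs refl refl], of f n]
  by (simp add: length_vertex_pairs set_vertex_pairs)

text \<open>The row of a pair has entries in two columns only, and these cancel unless
  \<open>S\<close> separates the pair.\<close>

lemma edge_matrix_mult_indicator_vec:
  assumes k: "k < n choose 2" and uv: "vertex_pairs n ! k = (u, v)"
  shows "(edge_matrix n W *\<^sub>v indicator_vec n S) $ k
    = sqrt (W u v) * (of_bool (u \<in> S) - of_bool (v \<in> S))"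
proof -
  have "(u, v) \<in> set (vertex_pairs n)"
    using nth_mem[of k "vertex_pairs n"] k uv by (simp add: length_vertex_pairs)
  then have lt: "u < v" "v < n" by (auto simp: set_vertex_pairs)
  have "(edge_matrix n W *\<^sub>v indicator_vec n S) $ k
      = (\<Sum>j=0..<n. (if j = u then sqrt (W u v) else if j = v then - sqrt (W u v) else 0)
          * of_bool (j \<in> S))"
    using k uv by (simp add: edge_matrix_def indicator_vec_def scalar_prod_def of_bool_def)
  \<comment> \<open>The nested conditional splits into two one-point sums because \<open>u\<close>
    and \<open>v\<close> differ.\<close>
  also have "\<dots> = (\<Sum>j=0..<n. (if j = u then sqrt (W u v) * of_bool (u \<in> S) else 0)
      - (if j = v then sqrt (W u v) * of_bool (v \<in> S) else 0))"
    using lt by (intro sum.cong) auto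
  also have "\<dots> = sqrt (W u v) * (of_bool (u \<in> S) - of_bool (v \<in> S))"
    using lt by (simp add: sum_subtractf algebra_simps)
  finally show ?thesis .
qed

text \<open>Squaring removes the orientation sign, so each pair separated by \<open>S\<close>
  contributes its weight once.\<close>

lemma sum_squares_edge_matrix_indicator:
  assumes S: "S \<subseteq> {..<n}"
    and W: "\<And>u v. u < n \<Longrightarrow> v < n \<Longrightarrow> u \<noteq> v \<Longrightarrow> W u v = W v u \<and> 0 \<le> W u v"
  shows "(\<Sum>k<n choose 2. ((edge_matrix n W *\<^sub>v indicator_vec n S) $ k)\<^sup>2) = cut_value n W S"
proof -
  let ?A = "{(u, v). u < v \<and> v < n \<and> (u \<in> S) \<noteq> (v \<in> S)}"
  have fin: "finite {(u, v). u < v \<and> v < n}"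
    by (rule finite_subset[of _ "{..<n} \<times> {..<n}"]) auto
  have "(\<Sum>k<n choose 2. ((edge_matrix n W *\<^sub>v indicator_vec n S) $ k)\<^sup>2)
    = (\<Sum>k<n choose 2. (\<lambda>(u, v). (sqrt (W u v) * (of_bool (u \<in> S) - of_bool (v \<in> S)))\<^sup>2) (vertex_pairs n ! k))"
    by (intro sum.cong refl) (auto simp: edge_matrix_mult_indicator_vec split: prod.splits)
  also have "\<dots> = (\<Sum>(u, v)\<in>{(u, v). u < v \<and> v < n}. (sqrt (W u v) * (of_bool (u \<in> S) - of_bool (v \<in> S)))\<^sup>2)"
    by (rule sum_vertex_pairs)
  also have "\<dots> = (\<Sum>(u, v)\<in>?A. W u v)"
    using W by (intro sum.mono_neutral_cong_right fin) (auto simp: power_mult_distrib)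
  \<comment> \<open>The map \<open>j\<close> orients a separated pair to start in \<open>S\<close>,
    and \<open>i\<close> sorts it back; symmetry of \<open>W\<close> makes the weights
    agree.\<close>
  also have "\<dots> = (\<Sum>(u, v)\<in>S \<times> ({..<n} - S). W u v)"
    using S W
    by (intro sum.reindex_bij_witness[where
          i="\<lambda>(u, v). if u < v then (u, v) else (v, u)" and j="\<lambda>(u, v). if u \<in> S then (u, v) else (v, u)"])
      (auto split: if_splits simp: not_less le_less)
  also have "\<dots> = cut_value n W S"
    by (simp add: cut_value_def sum.cartesian_product)
  finally show ?thesis .
qed

text \<open>All \<open>s * (n - s)\<close> crossing pairs receive the extra weight
  \<open>w / n\<close>. The result is the affine map that \<open>cut_estimate\<close>
  inverts.\<close>

lemma cut_value_perturbed_graph: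
  assumes "S \<subseteq> {..<n}"
  shows "cut_value n (perturbed_graph n w W) S
    = w * (real (card S) * (real n - real (card S)) / real n) + (1 - w / real n) * cut_value n W S"
proof -
  have S: "finite S" "card S \<le> n" using assms finite_subset card_mono[OF _ assms] by auto
  have "cut_value n (perturbed_graph n w W) S
      = (\<Sum>u\<in>S. \<Sum>v\<in>{..<n} - S. w / real n + (1 - w / real n) * W u v)"
    unfolding cut_value_def by (intro sum.cong refl) (auto simp: perturbed_graph_def)
  also have "\<dots> = real (card S) * (real (card ({..<n} - S)) * (w / real n))
      + (1 - w / real n) * cut_value n W S"
    by (simp add: sum.distrib cut_value_def sum_distrib_left)
  also have "card ({..<n} - S) = n - card S"
    using assms by (simp add: card_Diff_subset S)
  finally show ?thesis using S by simp
qed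

text \<open>Both transposes are moved across the scalar product, which leaves the squared norm of
  \<open>M *\<^sub>v x\<close>. It is expanded in coordinates to match the row sums of the
  concentration bound.\<close>

lemma indicator_quadratic_sanitized_laplacian:
  fixes W :: "nat \<Rightarrow> nat \<Rightarrow> real" and w :: real and n :: nat and S :: "nat set"
  defines "x \<equiv> edge_matrix n (perturbed_graph n w W) *\<^sub>v indicator_vec n S"
  shows "indicator_vec n S \<bullet> (sanitized_laplacian n r w W \<omega> *\<^sub>v indicator_vec n S)
    = (\<Sum>i<r. (\<Sum>j<n choose 2. \<omega> (i, j) * x $ j)\<^sup>2) / real r"
proof -
  let ?m = "n choose 2"
  define E where "E = edge_matrix n (perturbed_graph n w W)"
  define M where "M = mat r ?m \<omega>"
  define h where "h = indicator_vec n S"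
  have E: "E \<in> carrier_mat ?m n" by (simp add: E_def edge_matrix_def)
  have M: "M \<in> carrier_mat r ?m" by (simp add: M_def)
  have h: "h \<in> carrier_vec n" by (simp add: h_def indicator_vec_def)
  have Et: "E\<^sup>T \<in> carrier_mat n ?m" and Mt: "M\<^sup>T \<in> carrier_mat ?m r" using E M by auto
  have x: "x = E *\<^sub>v h" by (simp add: x_def E_def h_def)
  have xc: "x \<in> carrier_vec ?m" and Mx: "M *\<^sub>v x \<in> carrier_vec r"
    unfolding x using E M h by auto
  have "((1 / real r) \<cdot>\<^sub>m (E\<^sup>T * M\<^sup>T * M * E)) *\<^sub>v h = (1 / real r) \<cdot>\<^sub>v ((E\<^sup>T * M\<^sup>T * M * E) *\<^sub>v h)"
    using E M h by (intro eq_vecI) auto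
  also have "(E\<^sup>T * M\<^sup>T * M * E) *\<^sub>v h = E\<^sup>T *\<^sub>v (M\<^sup>T *\<^sub>v (M *\<^sub>v x))"
  proof -
    have "(E\<^sup>T * M\<^sup>T * M * E) *\<^sub>v h = (E\<^sup>T * M\<^sup>T * M) *\<^sub>v x"
      unfolding x by (rule assoc_mult_mat_vec[OF mult_carrier_mat[OF mult_carrier_mat[OF Et Mt] M] E h])
    also have "\<dots> = (E\<^sup>T * M\<^sup>T) *\<^sub>v (M *\<^sub>v x)"
      by (rule assoc_mult_mat_vec[OF mult_carrier_mat[OF Et Mt] M xc])
    also have "\<dots> = E\<^sup>T *\<^sub>v (M\<^sup>T *\<^sub>v (M *\<^sub>v x))"
      by (rule assoc_mult_mat_vec[OF Et Mt Mx])
    finally show ?thesis .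
  qed
  finally have "h \<bullet> (((1 / real r) \<cdot>\<^sub>m (E\<^sup>T * M\<^sup>T * M * E)) *\<^sub>v h)
      = 1 / real r * (h \<bullet> (E\<^sup>T *\<^sub>v (M\<^sup>T *\<^sub>v (M *\<^sub>v x))))"
    using E h by simp
  also have "h \<bullet> (E\<^sup>T *\<^sub>v (M\<^sup>T *\<^sub>v (M *\<^sub>v x))) = (M *\<^sub>v x) \<bullet> (M *\<^sub>v x)"
  proof -
    have c: "M\<^sup>T *\<^sub>v (M *\<^sub>v x) \<in> carrier_vec ?m" using Mt Mx by auto
    have "h \<bullet> (E\<^sup>T *\<^sub>v (M\<^sup>T *\<^sub>v (M *\<^sub>v x))) = (E\<^sup>T *\<^sub>v (M\<^sup>T *\<^sub>v (M *\<^sub>v x))) \<bullet> h"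
      using h Et c by (intro comm_scalar_prod) auto
    also have "\<dots> = (M\<^sup>T *\<^sub>v (M *\<^sub>v x)) \<bullet> x"
      unfolding x by (rule transpose_vec_mult_scalar[OF E h]) (use c x in simp)
    also have "\<dots> = (M *\<^sub>v x) \<bullet> (M *\<^sub>v x)"
      by (rule transpose_vec_mult_scalar[OF M xc Mx])
    finally show ?thesis .
  qed
  also have "\<dots> = (\<Sum>i<r. (\<Sum>j<?m. \<omega> (i, j) * x $ j)\<^sup>2)"
    using xc by (simp add: M_def scalar_prod_def power2_eq_square atLeast0LessThan)
  finally show ?thesis
    by (simp add: sanitized_laplacian_def Let_def E_def M_def h_def)
qed

section \<open>The additive error\<close>

text \<open>The factor 2 pays for dividing by \<open>1 - w / n\<close>, which exceeds 1/2.\<close>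

definition additive_error :: "real \<Rightarrow> real \<Rightarrow> real \<Rightarrow> real \<Rightarrow> nat \<Rightarrow> real" where
  "additive_error \<epsilon> \<delta> \<eta> \<nu> s = 2 * \<eta> * base_weight \<epsilon> \<delta> \<eta> \<nu> * real s"

text \<open>The constant is 2 * 34 * 21: the factor 2 of \<open>additive_error\<close>, 34 from the
  square root and 21 from the logarithm in \<open>base_weight\<close>.\<close>

lemma additive_error_le:
  assumes "0 < \<epsilon>" "0 < \<delta>" "\<delta> \<le> 1/2" "0 < \<eta>" "\<eta> \<le> 1" "0 < \<nu>" "\<nu> \<le> 1/2"
  shows "\<bar>additive_error \<epsilon> \<delta> \<eta> \<nu> s\<bar> \<le> 1428 * error_order \<epsilon> \<delta> \<eta> \<nu> s"
proof -
  define r where "r = real (num_rows \<eta> \<nu>)"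
  define A where "A = ln (1 / \<nu>) / \<eta>\<^sup>2"
  define D where "D = ln (1 / \<delta>)"
  define B where "B = D + ln A"
  have ln2: "ln 2 \<ge> (2 / 3 :: real)" by (rule ln2_ge_two_thirds)
  have half: "ln 2 \<le> ln (1 / y)" "ln (2 / y) = ln 2 + ln (1 / y)" if "0 < y" "y \<le> 1/2" for y :: real
  proof -
    have "2 \<le> 1 / y" using that by (simp add: field_simps)
    then show "ln 2 \<le> ln (1 / y)" using that by (subst ln_le_cancel_iff) auto
    show "ln (2 / y) = ln 2 + ln (1 / y)" using that by (simp add: ln_div)
  qed
  have \<eta>2: "0 < \<eta>\<^sup>2" "\<eta>\<^sup>2 \<le> 1" using assms by (auto simp: power_le_one)
  have A: "ln 2 \<le> A"
  proof -
    have "ln 2 * \<eta>\<^sup>2 \<le> ln 2 * 1" using \<eta>2 by (intro mult_left_mono) auto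
    also have "\<dots> \<le> ln (1 / \<nu>)" using half assms by simp
    finally show ?thesis using \<eta>2 by (simp add: A_def pos_le_divide_eq)
  qed
  have D: "ln 2 \<le> D" using half assms by (simp add: D_def)
  \<comment> \<open>As \<open>A\<close> may be below 1, \<open>ln A\<close> may be negative;
    \<open>D\<close> outweighs it because \<open>2 * ln 2\<close> is at least 4/3. A positive lower
    bound on \<open>B\<close> is needed to absorb additive constants.\<close>
  have B: "1 / 4 \<le> B"
  proof -
    have "1 / 4 \<le> ln (4 / 3 :: real)" using ln_add_one_self_le_self2[of "-1/4"] by (simp add: ln_div)
    also have "\<dots> \<le> ln (2 * ln 2)" using ln2 by (subst ln_le_cancel_iff) auto
    also have "\<dots> = ln 2 + ln (ln 2)" by (simp add: ln_mult)
    also have "\<dots> \<le> D + ln A" using A D ln2 by (intro add_mono iffD2[OF ln_le_cancel_iff]) auto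
    finally show ?thesis by (simp add: B_def)
  qed
  \<comment> \<open>Replacing \<open>2 / \<nu>\<close> by \<open>1 / \<nu>\<close> at most doubles
    the logarithm, giving \<open>16 * A\<close>; rounding up adds at most 1, which is below
    \<open>2 * A\<close>.\<close>
  have r: "0 < r" "r \<le> 18 * A"
  proof -
    have pos: "0 < 8 * ln (2 / \<nu>) / \<eta>\<^sup>2" using half assms \<eta>2 ln2 by (simp add: ln_div)
    then show "0 < r" by (simp add: r_def num_rows_def)
    have "r \<le> 8 * ln (2 / \<nu>) / \<eta>\<^sup>2 + 1"
      using pos by (simp add: r_def num_rows_def)
    also have "8 * ln (2 / \<nu>) / \<eta>\<^sup>2 \<le> 16 * ln (1 / \<nu>) / \<eta>\<^sup>2"
      using half[of \<nu>] assms by (intro divide_right_mono) auto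
    also have "\<dots> + 1 \<le> 18 * A" using A ln2 by (simp add: A_def)
    finally show "r \<le> 18 * A" by simp
  qed
  have r1: "1 \<le> r" using r(1) by (simp add: r_def)
  have Apos: "0 < A" and Dpos: "0 < D" using A D ln2 by auto
  have log_nonneg: "0 \<le> ln (4 * r / \<delta>)"
    using r1 assms by (intro ln_ge_zero) (auto simp: field_simps)
  \<comment> \<open>Here 72 is 4 * 18 and \<open>ln 72\<close> is at most 5, which is at most
    \<open>20 * B\<close>.\<close>
  have log_le: "ln (4 * r / \<delta>) \<le> 21 * B"
  proof -
    have "ln (4 * r / \<delta>) = ln (4 * r) + D" using r assms by (simp add: D_def ln_div)
    also have "ln (4 * r) \<le> ln (72 * A)" using r by (subst ln_le_cancel_iff) auto
    also have "\<dots> = ln 72 + ln A" using Apos by (simp add: ln_mult)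
    also have "ln 72 \<le> (5 :: real)"
    proof -
      have "ln 72 \<le> ln ((5 / 2 :: real) ^ 5)" by (subst ln_le_cancel_iff) (auto simp: eval_nat_numeral)
      also have "\<dots> = 5 * ln (5 / 2)" by (subst ln_realpow) auto
      also have "ln (5 / 2 :: real) \<le> ln (exp 1)"
        using exp_lower_Taylor_quadratic[of "1 :: real"] by (subst ln_le_cancel_iff) auto
      finally show ?thesis by simp
    qed
    finally show ?thesis using B by (simp add: B_def)
  qed
  \<comment> \<open>Under the root, \<eta>^2 cancels the denominator of \<open>A\<close>, and 32 *
    18 * 2 = 1152 lies below the square of 34.\<close>
  have sqrt_le: "\<eta> * sqrt (32 * r * ln (2 / \<delta>)) \<le> 34 * sqrt (D * ln (1 / \<nu>))"
  proof -
    have "\<eta> * sqrt (32 * r * ln (2 / \<delta>)) = sqrt (\<eta>\<^sup>2 * (32 * r * ln (2 / \<delta>)))"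
      using assms by (simp add: real_sqrt_mult)
    also have "\<dots> \<le> sqrt (34\<^sup>2 * (D * ln (1 / \<nu>)))"
    proof (rule real_sqrt_le_mono)
      have "ln (2 / \<delta>) \<le> 2 * D" using half[of \<delta>] assms by (simp add: D_def)
      then have "r * ln (2 / \<delta>) \<le> (18 * A) * (2 * D)"
        using r Apos half[of \<delta>] ln2 assms Dpos by (intro mult_mono) (auto simp: D_def[symmetric])
      then have "\<eta>\<^sup>2 * (32 * (r * ln (2 / \<delta>))) \<le> \<eta>\<^sup>2 * (32 * ((18 * A) * (2 * D)))"
        using \<eta>2 by (intro mult_left_mono) auto
      also have "\<dots> = 1152 * (D * ln (1 / \<nu>))" using \<eta>2 by (simp add: A_def)
      also have "\<dots> \<le> 34\<^sup>2 * (D * ln (1 / \<nu>))"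
        using Dpos half[of \<nu>] ln2 assms by (intro mult_right_mono mult_nonneg_nonneg) auto
      finally show "\<eta>\<^sup>2 * (32 * r * ln (2 / \<delta>)) \<le> 34\<^sup>2 * (D * ln (1 / \<nu>))" by (simp add: mult.assoc)
    qed
    also have "\<dots> = 34 * sqrt (D * ln (1 / \<nu>))" by (simp add: real_sqrt_mult)
    finally show ?thesis .
  qed
  have nonneg: "0 \<le> base_weight \<epsilon> \<delta> \<eta> \<nu>"
    using log_nonneg r half[of \<delta>] ln2 assms
    by (auto simp: base_weight_def Let_def r_def[symmetric] intro!: mult_nonneg_nonneg divide_nonneg_nonneg)
  then have "\<bar>additive_error \<epsilon> \<delta> \<eta> \<nu> s\<bar> = additive_error \<epsilon> \<delta> \<eta> \<nu> s"
    using assms by (simp add: additive_error_def)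
  also have "\<dots> = 2 * real s / \<epsilon> * ((\<eta> * sqrt (32 * r * ln (2 / \<delta>))) * ln (4 * r / \<delta>))"
    by (simp add: additive_error_def base_weight_def Let_def r_def mult_ac)
  also have "\<dots> \<le> 2 * real s / \<epsilon> * ((34 * sqrt (D * ln (1 / \<nu>))) * (21 * B))"
    using Dpos half(1)[of \<nu>] ln2 log_nonneg assms
    by (intro mult_left_mono[OF mult_mono[OF sqrt_le log_le]]) auto
  also have "\<dots> = 1428 * error_order \<epsilon> \<delta> \<eta> \<nu> s"
    by (simp add: error_order_def A_def B_def D_def)
  finally show ?thesis .
qed

section \<open>From the quadratic form to the cut estimate\<close>

lemma failure_probability_num_rows:
  assumes "0 < \<eta>" "0 < \<nu>"
  shows "2 * exp (- (real (num_rows \<eta> \<nu>) * \<eta>\<^sup>2 / 8)) \<le> \<nu>"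
proof -
  \<comment> \<open>Rounding up, as well as truncation at 0 when \<nu> exceeds 2, can only increase
    the number of rows.\<close>
  have "8 * ln (2 / \<nu>) / \<eta>\<^sup>2 \<le> real (num_rows \<eta> \<nu>)"
    unfolding num_rows_def by linarith
  then have "ln (2 / \<nu>) \<le> real (num_rows \<eta> \<nu>) * \<eta>\<^sup>2 / 8"
    using assms by (simp add: field_simps)
  then have "exp (- (real (num_rows \<eta> \<nu>) * \<eta>\<^sup>2 / 8)) \<le> exp (- ln (2 / \<nu>))" by simp
  also have "\<dots> = \<nu> / 2" using assms by (simp add: exp_minus)
  finally show ?thesis by simp
qed

text \<open>The deterministic half: with \<open>c = 1 - w / n\<close> and added weight
  \<open>z\<close>, the error \<open>\<eta> * (z + c * \<Phi>)\<close> divided by \<open>c\<close>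
  is the wanted relative error plus \<open>\<eta> * z / c\<close>. The latter is at most
  \<open>2 * \<eta> * w * s\<close>, since \<open>z\<close> is at most \<open>w * s\<close> and
  \<open>c\<close> exceeds 1/2.\<close>

lemma cut_estimate_bounds:
  fixes w \<eta> \<Phi> q :: real and n s :: nat
  assumes w: "0 < w" "w / n < 1/2" and sn: "s < n" and \<eta>: "0 < \<eta>"
    and q: "\<bar>q - (w * (s * (real n - s) / n) + (1 - w / n) * \<Phi>)\<bar>
      \<le> \<eta> * (w * (s * (real n - s) / n) + (1 - w / n) * \<Phi>)"
  shows "(1 - \<eta>) * \<Phi> - 2 * \<eta> * w * s \<le> 1 / (1 - w / n) * (q - w * (s * (real n - s) / n))"
    and "1 / (1 - w / n) * (q - w * (s * (real n - s) / n)) \<le> (1 + \<eta>) * \<Phi> + 2 * \<eta> * w * s"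
proof -
  define c where "c = 1 - w / n"
  define z where "z = w * (s * (real n - s) / n)"
  have c: "1/2 < c" using w by (simp add: c_def)
  have "s * (real n - s) / n \<le> s" using sn by (simp add: field_simps)
  then have "z \<le> w * s" unfolding z_def using w by (intro mult_left_mono) auto
  then have "\<eta> * z \<le> \<eta> * (w * s)" using \<eta> by (intro mult_left_mono) auto
  also have "\<dots> * 1 \<le> \<eta> * (w * s) * (2 * c)" using w \<eta> c by (intro mult_left_mono) auto
  finally have z: "\<eta> * z \<le> c * (2 * \<eta> * w * s)" by (simp add: mult_ac)
  have q': "\<bar>q - (z + c * \<Phi>)\<bar> \<le> \<eta> * (z + c * \<Phi>)" using q by (simp add: z_def c_def)
  have "c * ((1 - \<eta>) * \<Phi> - 2 * \<eta> * w * s) \<le> q - z"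
    using q' z by (simp add: algebra_simps abs_le_iff)
  then show "(1 - \<eta>) * \<Phi> - 2 * \<eta> * w * s \<le> 1 / (1 - w / n) * (q - w * (s * (real n - s) / n))"
    using c unfolding c_def[symmetric] z_def[symmetric] by (simp add: pos_le_divide_eq mult.commute)
  have "q - z \<le> c * ((1 + \<eta>) * \<Phi> + 2 * \<eta> * w * s)"
    using q' z by (simp add: algebra_simps abs_le_iff)
  then show "1 / (1 - w / n) * (q - w * (s * (real n - s) / n)) \<le> (1 + \<eta>) * \<Phi> + 2 * \<eta> * w * s"
    using c unfolding c_def[symmetric] z_def[symmetric] by (simp add: pos_divide_le_eq mult.commute)
qed

lemma cut_estimate_concentration:
  fixes W :: "nat \<Rightarrow> nat \<Rightarrow> real"
  assumes \<eta>: "0 < \<eta>" "\<eta> \<le> 1" and r: "0 < r" and w: "0 < w" "w / real n < 1/2"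
    and W: "weighted_graph n W" and S: "S \<noteq> {}" "S \<subset> {..<n}"
  shows "1 - 2 * exp (- (real r * \<eta>\<^sup>2 / 8)) \<le> measure (gaussian_entries r (n choose 2))
    {\<omega> \<in> space (gaussian_entries r (n choose 2)).
      (1 - \<eta>) * cut_value n W S - 2 * \<eta> * w * real (card S)
        \<le> cut_estimate n w (sanitized_laplacian n r w W \<omega>) S \<and>
      cut_estimate n w (sanitized_laplacian n r w W \<omega>) S
        \<le> (1 + \<eta>) * cut_value n W S + 2 * \<eta> * w * real (card S)}"
proof -
  let ?P = "gaussian_entries r (n choose 2)"
  interpret prob_space ?P by (rule prob_space_gaussian_entries)
  define H where "H = perturbed_graph n w W"
  define x where "x = edge_matrix n H *\<^sub>v indicator_vec n S"
  define Q where "Q \<omega> = (\<Sum>i<r. (\<Sum>j<n choose 2. \<omega> (i, j) * x $ j)\<^sup>2)" for \<omega> :: "nat \<times> nat \<Rightarrow> real"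
  define V where "V = w * (real (card S) * (real n - real (card S)) / real n) + (1 - w / real n) * cut_value n W S"
  have fin: "finite S" using S by (auto intro: finite_subset)
  have cardS: "0 < card S" "card S < n"
    using S fin psubset_card_mono[OF _ S(2)] by (auto simp: card_gt_0_iff)
  have H: "H u v = H v u \<and> 0 \<le> H u v" if "u < n" "v < n" "u \<noteq> v" for u v
    using that W w by (auto simp: H_def perturbed_graph_def weighted_graph_def)
  have V: "(\<Sum>j<n choose 2. (x $ j)\<^sup>2) = V"
    using sum_squares_edge_matrix_indicator[of S n H] S H cut_value_perturbed_graph[of S n w W]
    by (simp add: x_def H_def V_def less_imp_le psubset_imp_subset)
  have "0 \<le> cut_value n W S"
    unfolding cut_value_def using W S by (intro sum_nonneg) (auto simp: weighted_graph_def)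
  \<comment> \<open>Even when no edge of the original graph crosses the cut, the added weight is
    positive because \<open>S\<close> is nonempty and proper. This gives the nonzero vector that the
    concentration bound requires.\<close>
  then have "0 < V"
    using w cardS unfolding V_def
    by (intro add_pos_nonneg mult_pos_pos divide_pos_pos mult_nonneg_nonneg) auto
  \<comment> \<open>As an affine function of \<open>Q\<close>, the estimate is visibly
    measurable.\<close>
  have R: "cut_estimate n w (sanitized_laplacian n r w W \<omega>) S
      = 1 / (1 - w / real n) * (Q \<omega> / real r - w * (real (card S) * (real n - real (card S)) / real n))" for \<omega>
    unfolding cut_estimate_def indicator_quadratic_sanitized_laplacian Q_def x_def H_def ..
  have [measurable]: "Q \<in> borel_measurable ?P"
    unfolding Q_def
    by (intro borel_measurable_sum borel_measurable_power borel_measurable_times measurable_gaussian_entry) auto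
  have "1 - 2 * exp (- (real r * \<eta>\<^sup>2 / 8)) \<le> prob {\<omega> \<in> space ?P. \<bar>Q \<omega> / r - V\<bar> \<le> \<eta> * V}"
    using gaussian_quadratic_concentration[of "\<lambda>j. x $ j" "n choose 2" r \<eta>] \<open>0 < V\<close> r \<eta>
    by (simp add: V Q_def)
  \<comment> \<open>The concentration event is contained in the approximation event, pointwise by
    the deterministic bounds.\<close>
  also have "\<dots> \<le> prob {\<omega> \<in> space ?P.
      (1 - \<eta>) * cut_value n W S - 2 * \<eta> * w * real (card S)
        \<le> cut_estimate n w (sanitized_laplacian n r w W \<omega>) S \<and>
      cut_estimate n w (sanitized_laplacian n r w W \<omega>) S
        \<le> (1 + \<eta>) * cut_value n W S + 2 * \<eta> * w * real (card S)}"
    unfolding R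
  proof (rule finite_measure_mono, safe)
    fix \<omega> assume "\<bar>Q \<omega> / r - V\<bar> \<le> \<eta> * V"
    note bounds = cut_estimate_bounds[OF w cardS(2) \<eta>(1) this[unfolded V_def]]
    show "(1 - \<eta>) * cut_value n W S - 2 * \<eta> * w * real (card S)
      \<le> 1 / (1 - w / real n) * (Q \<omega> / real r - w * (real (card S) * (real n - real (card S)) / real n))"
      by (rule bounds(1))
    show "1 / (1 - w / real n) * (Q \<omega> / real r - w * (real (card S) * (real n - real (card S)) / real n))
      \<le> (1 + \<eta>) * cut_value n W S + 2 * \<eta> * w * real (card S)"
      by (rule bounds(2))
  qed measurable
  finally show ?thesis .
qed

text \<open>Choosing \<open>C\<close> and \<tau> before all parameters makes the constant absolute
  and the error independent of the graph. The order bound is confined to \<delta> and \<nu> up to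
  1/2, where \<open>error_order\<close> stays meaningful; the probability bound is not.\<close>

theorem theorem3:
  shows "\<exists>C>0. \<exists>\<tau> :: real \<Rightarrow> real \<Rightarrow> real \<Rightarrow> real \<Rightarrow> nat \<Rightarrow> real.
    (\<forall>\<epsilon> \<delta> \<eta> \<nu> s. 0 < \<epsilon> \<longrightarrow> 0 < \<delta> \<longrightarrow> \<delta> \<le> 1/2 \<longrightarrow> 0 < \<eta> \<longrightarrow> \<eta> \<le> 1 \<longrightarrow> 0 < \<nu> \<longrightarrow> \<nu> \<le> 1/2 \<longrightarrow>
       \<bar>\<tau> \<epsilon> \<delta> \<eta> \<nu> s\<bar> \<le> C * error_order \<epsilon> \<delta> \<eta> \<nu> s) \<and>
    (\<forall>\<epsilon> \<delta> \<eta> \<nu> n W S. 0 < \<epsilon> \<longrightarrow> 0 < \<delta> \<longrightarrow> 0 < \<eta> \<longrightarrow> \<eta> \<le> 1 \<longrightarrow> 0 < \<nu> \<longrightarrow>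
       (let r = num_rows \<eta> \<nu>;
            w = base_weight \<epsilon> \<delta> \<eta> \<nu>;
            P = gaussian_entries r (n choose 2)
        in 0 < w \<longrightarrow> w / real n < 1/2 \<longrightarrow> 1 / w < 1/2 \<longrightarrow>
           weighted_graph n W \<longrightarrow> S \<noteq> {} \<longrightarrow> S \<subset> {..<n} \<longrightarrow>
           measure P {\<omega> \<in> space P.
               let R = cut_estimate n w (sanitized_laplacian n r w W \<omega>) S;
                   t = \<tau> \<epsilon> \<delta> \<eta> \<nu> (card S)
               in (1 - \<eta>) * cut_value n W S - t \<le> R \<and> R \<le> (1 + \<eta>) * cut_value n W S + t}
             \<ge> 1 - \<nu>))"
proof (intro exI[of _ "1428 :: real"] exI[of _ additive_error] conjI allI impI)
  fix \<epsilon> \<delta> \<eta> \<nu> :: real and n :: nat and W S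
  assume *: "0 < \<epsilon>" "0 < \<delta>" "0 < \<eta>" "\<eta> \<le> 1" "0 < \<nu>"
  show "let r = num_rows \<eta> \<nu>; w = base_weight \<epsilon> \<delta> \<eta> \<nu>; P = gaussian_entries r (n choose 2)
    in 0 < w \<longrightarrow> w / real n < 1/2 \<longrightarrow> 1 / w < 1/2 \<longrightarrow>
       weighted_graph n W \<longrightarrow> S \<noteq> {} \<longrightarrow> S \<subset> {..<n} \<longrightarrow>
       measure P {\<omega> \<in> space P.
           let R = cut_estimate n w (sanitized_laplacian n r w W \<omega>) S;
               t = additive_error \<epsilon> \<delta> \<eta> \<nu> (card S)
           in (1 - \<eta>) * cut_value n W S - t \<le> R \<and> R \<le> (1 + \<eta>) * cut_value n W S + t}
         \<ge> 1 - \<nu>"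
    unfolding Let_def additive_error_def
  proof (intro impI)
    assume w: "0 < base_weight \<epsilon> \<delta> \<eta> \<nu>" "base_weight \<epsilon> \<delta> \<eta> \<nu> / real n < 1/2"
      and WS: "weighted_graph n W" "S \<noteq> {}" "S \<subset> {..<n}"
    \<comment> \<open>With no rows the square root in \<open>base_weight\<close> would vanish,
      contradicting the positive weight.\<close>
    have "0 < num_rows \<eta> \<nu>"
      using w(1) by (cases "num_rows \<eta> \<nu> = 0") (auto simp: base_weight_def)
    from order.trans[OF _ cut_estimate_concentration[OF *(3,4) this w WS]]
    show "1 - \<nu> \<le> measure (gaussian_entries (num_rows \<eta> \<nu>) (n choose 2))
      {\<omega> \<in> space (gaussian_entries (num_rows \<eta> \<nu>) (n choose 2)).
        (1 - \<eta>) * cut_value n W S - 2 * \<eta> * base_weight \<epsilon> \<delta> \<eta> \<nu> * real (card S)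
          \<le> cut_estimate n (base_weight \<epsilon> \<delta> \<eta> \<nu>)
              (sanitized_laplacian n (num_rows \<eta> \<nu>) (base_weight \<epsilon> \<delta> \<eta> \<nu>) W \<omega>) S \<and>
        cut_estimate n (base_weight \<epsilon> \<delta> \<eta> \<nu>)
            (sanitized_laplacian n (num_rows \<eta> \<nu>) (base_weight \<epsilon> \<delta> \<eta> \<nu>) W \<omega>) S
          \<le> (1 + \<eta>) * cut_value n W S + 2 * \<eta> * base_weight \<epsilon> \<delta> \<eta> \<nu> * real (card S)}"
      using failure_probability_num_rows[OF *(3,5)] by simp
  qed
qed (use additive_error_le in auto)

end
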